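(* For all integers $N\ge 2$ and $k$ with $0<k<N$, \[ \theta(J(N,k)) \le \binom{N-2}{k-1}. \]
   Context: For integers $0<k<N$, let $[N]=\{1,\dots,N\}$ and let $\mathcal{P}_k([N])$ be the set of $k$-element subsets of $[N]$. The Johnson graph $J(N,k)$ has vertex set $\mathcal{P}_k([N])$, two vertices $S_1,S_2$ being adjacent iff $|S_1\cap S_2| = k-1$. A (vertex) clique cover of a graph $G$ is a collection of cliques of $G$ whose vertex sets together contain every vertex of $G$; $\theta(G)$ denotes the smallest cardinality of a clique cover of $G$. *)

theory Defs
  imports Complex_Main "HOL-Library.Ramsey"
begin

text \<open>
  Simple graphs are pairs of a vertex set and a set of edges, each edge being a two-element
  set of vertices. This is the edge representation that \<^const>\<open>clique\<close> expects.
\<close>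

type_synonym 'a graph = "'a set \<times> 'a set set"

text \<open>
  Adjacency \<open>card (S \<inter> T) = k - 1\<close> is written without truncated subtraction,
  so that no loops arise for any \<open>k\<close>.
\<close>

definition johnson_graph :: "nat \<Rightarrow> nat \<Rightarrow> nat set graph" where
  "johnson_graph N k =
    (nsets {1..N} k,
     {{S, T} | S T. S \<in> nsets {1..N} k \<and> T \<in> nsets {1..N} k \<and> card (S \<inter> T) + 1 = k})"

definition clique_cover :: "'a graph \<Rightarrow> 'a set set \<Rightarrow> bool" where
  "clique_cover G C \<longleftrightarrow>
    (\<forall>Q\<in>C. Q \<subseteq> fst G \<and> clique Q (snd G)) \<and> fst G \<subseteq> \<Union>C"

text \<open>
  Finiteness is required because the cardinality of an infinite set is \<open>0\<close>. The value is
  meaningful only for graphs that have a finite clique cover, in particular for all finite graphs.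
\<close>

definition clique_cover_number :: "'a graph \<Rightarrow> nat" (\<open>\<theta>\<close>) where
  "\<theta> G = (LEAST n. \<exists>C. finite C \<and> clique_cover G C \<and> card C = n)"

lemma johnson_edges_subset:
  "snd (johnson_graph N k) \<subseteq> nsets (fst (johnson_graph N k)) 2"
  by (auto simp: johnson_graph_def) (auto simp: nsets_def)

lemma johnson_adjacent_iff:
  assumes "0 < k" "S \<in> nsets {1..N} k" "T \<in> nsets {1..N} k"
  shows "{S, T} \<in> snd (johnson_graph N k) \<longleftrightarrow> card (S \<inter> T) = k - 1"
proof
  assume "{S, T} \<in> snd (johnson_graph N k)"
  then show "card (S \<inter> T) = k - 1"
    by (auto simp: johnson_graph_def doubleton_eq_iff Int_commute)
next
  assume "card (S \<inter> T) = k - 1"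
  with assms have "card (S \<inter> T) + 1 = k" by simp
  with assms show "{S, T} \<in> snd (johnson_graph N k)"
    unfolding johnson_graph_def snd_conv by blast
qed

lemma clique_cover_number_attained:
  assumes "finite (fst G)"
  shows "\<exists>C. finite C \<and> clique_cover G C \<and> card C = \<theta> G"
  unfolding clique_cover_number_def
proof (rule LeastI_ex)
  have "clique_cover G ((\<lambda>v. {v}) ` fst G)"
    by (auto simp: clique_cover_def clique_def)
  with assms show "\<exists>n C. finite C \<and> clique_cover G C \<and> card C = n"
    by blast
qed

lemma clique_cover_number_le:
  assumes "finite C" "clique_cover G C"
  shows "\<theta> G \<le> card C"
  unfolding clique_cover_number_def using assms by (intro Least_le) blast

end

theory Submission
  imports Defs
begin

text \<open>
  Splitting the \<open>k\<close>-subsets of \<open>[N]\<close> according to whether they contain \<open>N\<close> gives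
  \<open>\<theta>(J(N,k)) \<le> \<theta>(J(N-1,k-1)) + \<theta>(J(N-1,k))\<close>, which is Pascal's recurrence for the
  claimed bound. The recursion stops at \<open>k = 1\<close> and \<open>k = N - 1\<close>, where the Johnson graph is
  complete and the binomial coefficient is \<open>1\<close>.
\<close>

text \<open>Deleting \<open>Suc N\<close> from a set that contains it leaves a
  \<open>k\<close>-subset of \<open>{1..N}\<close>; a set that avoids it already lies in
  \<open>{1..N}\<close>.\<close>

lemma nsets_atLeastAtMost_Suc_Suc:
  "nsets {1..Suc N} (Suc k) = nsets {1..N} (Suc k) \<union> insert (Suc N) ` nsets {1..N} k"
proof (intro equalityI subsetI)
  fix S assume S: "S \<in> nsets {1..Suc N} (Suc k)"
  show "S \<in> nsets {1..N} (Suc k) \<union> insert (Suc N) ` nsets {1..N} k"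
  proof (cases "Suc N \<in> S")
    case True
    with S have "S - {Suc N} \<in> nsets {1..N} k"
      by (auto simp: nsets_def le_Suc_eq)
    moreover from True have "S = insert (Suc N) (S - {Suc N})" by blast
    ultimately show ?thesis by blast
  next
    case False
    with S show ?thesis by (auto simp: nsets_def le_Suc_eq)
  qed
next
  fix S assume "S \<in> nsets {1..N} (Suc k) \<union> insert (Suc N) ` nsets {1..N} k"
  then show "S \<in> nsets {1..Suc N} (Suc k)"
  proof
    assume "S \<in> insert (Suc N) ` nsets {1..N} k"
    then obtain T where T: "T \<subseteq> {1..N}" "finite T" "card T = k" "S = insert (Suc N) T"
      by (auto simp: nsets_def)
    then have "Suc N \<notin> T" by auto
    with T show ?thesis by (auto simp: nsets_def)
  qed (auto simp: nsets_def)
qed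

lemma clique_johnson_graph_iff:
  assumes "Q \<subseteq> nsets {1..N} k"
  shows "clique Q (snd (johnson_graph N k)) \<longleftrightarrow>
    (\<forall>S\<in>Q. \<forall>T\<in>Q. S \<noteq> T \<longrightarrow> card (S \<inter> T) + 1 = k)"
proof -
  have "{S, T} \<in> snd (johnson_graph N k) \<longleftrightarrow> card (S \<inter> T) + 1 = k"
    if "S \<in> Q" "T \<in> Q" for S T
    using that assms by (auto simp: johnson_graph_def doubleton_eq_iff Int_commute)
  then show ?thesis by (auto simp: clique_def)
qed

text \<open>Cliques of a cover consist of vertices, so covering amounts to an equality of sets. In
  this form covers of two parts of the vertex set combine by a plain union of families.\<close>

lemma clique_cover_johnson_graph_iff:
  "clique_cover (johnson_graph N k) C \<longleftrightarrow>
    \<Union>C = nsets {1..N} k \<and>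
    (\<forall>Q\<in>C. \<forall>S\<in>Q. \<forall>T\<in>Q. S \<noteq> T \<longrightarrow> card (S \<inter> T) + 1 = k)"
proof -
  have "clique_cover (johnson_graph N k) C \<longleftrightarrow>
    \<Union>C = nsets {1..N} k \<and> (\<forall>Q\<in>C. clique Q (snd (johnson_graph N k)))"
    by (auto simp: clique_cover_def johnson_graph_def)
  also have "\<dots> \<longleftrightarrow> \<Union>C = nsets {1..N} k \<and>
    (\<forall>Q\<in>C. \<forall>S\<in>Q. \<forall>T\<in>Q. S \<noteq> T \<longrightarrow> card (S \<inter> T) + 1 = k)"
    by (intro conj_cong refl ball_cong clique_johnson_graph_iff) blast
  finally show ?thesis .
qed

lemma clique_cover_number_johnson_graph_attained:
  "\<exists>C. finite C \<and> clique_cover (johnson_graph N k) C \<and> card C = \<theta> (johnson_graph N k)"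
  by (intro clique_cover_number_attained) (simp add: johnson_graph_def finite_imp_finite_nsets)

text \<open>Adjoining \<open>Suc N\<close> to all members of a clique of \<open>k\<close>-sets
  enlarges each pairwise intersection by exactly one point, so the result is a clique of
  \<open>Suc k\<close>-sets. Cliques of \<open>johnson_graph N (Suc k)\<close> stay cliques
  unchanged.\<close>

lemma clique_cover_number_johnson_graph_Suc_Suc:
  "\<theta> (johnson_graph (Suc N) (Suc k)) \<le> \<theta> (johnson_graph N k) + \<theta> (johnson_graph N (Suc k))"
proof -
  obtain A where A: "finite A" "clique_cover (johnson_graph N k) A"
      "card A = \<theta> (johnson_graph N k)"
    using clique_cover_number_johnson_graph_attained by blast
  obtain B where B: "finite B" "clique_cover (johnson_graph N (Suc k)) B"
      "card B = \<theta> (johnson_graph N (Suc k))"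
    using clique_cover_number_johnson_graph_attained by blast
  define A' where "A' = (`) (insert (Suc N)) ` A"
  have UA: "\<Union>A = nsets {1..N} k"
    and adjA: "\<And>Q S T. \<lbrakk>Q \<in> A; S \<in> Q; T \<in> Q; S \<noteq> T\<rbrakk> \<Longrightarrow> card (S \<inter> T) + 1 = k"
    using A(2) by (auto simp: clique_cover_johnson_graph_iff)
  have "card (S \<inter> T) + 1 = Suc k" if "Q \<in> A'" "S \<in> Q" "T \<in> Q" "S \<noteq> T" for Q S T
  proof -
    from that obtain R S' T' where *: "R \<in> A" "S' \<in> R" "T' \<in> R" "S' \<noteq> T'"
        "S = insert (Suc N) S'" "T = insert (Suc N) T'"
      by (auto simp: A'_def)
    with UA have "S' \<in> nsets {1..N} k" by blast
    then have "finite S'" "Suc N \<notin> S'" by (auto simp: nsets_def)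
    moreover have "S \<inter> T = insert (Suc N) (S' \<inter> T')" using * by blast
    ultimately show ?thesis using adjA[OF *(1-4)] by simp
  qed
  moreover have "\<Union>A' = insert (Suc N) ` nsets {1..N} k"
    unfolding A'_def UA[symmetric] image_Union ..
  \<comment> \<open>\<open>A'\<close> covers the sets containing \<open>Suc N\<close>, and
    \<open>B\<close> covers those avoiding it.\<close>
  ultimately have "clique_cover (johnson_graph (Suc N) (Suc k)) (A' \<union> B)"
    using B(2)
    unfolding clique_cover_johnson_graph_iff nsets_atLeastAtMost_Suc_Suc Ball_def Un_iff
    by (simp add: Un_commute)
  then have "\<theta> (johnson_graph (Suc N) (Suc k)) \<le> card (A' \<union> B)"
    using A(1) B(1) by (intro clique_cover_number_le) (simp_all add: A'_def)
  also have "\<dots> \<le> card A' + card B" by (rule card_Un_le)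
  also have "card A' \<le> card A" unfolding A'_def using A(1) by (rule card_image_le)
  finally show ?thesis using A(3) B(3) by simp
qed

lemma clique_cover_number_johnson_graph_complete:
  assumes "\<And>S T. \<lbrakk>S \<in> nsets {1..N} k; T \<in> nsets {1..N} k; S \<noteq> T\<rbrakk> \<Longrightarrow> card (S \<inter> T) + 1 = k"
  shows "\<theta> (johnson_graph N k) \<le> 1"
proof -
  have "clique_cover (johnson_graph N k) {nsets {1..N} k}"
    using assms by (simp add: clique_cover_johnson_graph_iff)
  from clique_cover_number_le[OF _ this] show ?thesis by simp
qed

lemma clique_cover_number_johnson_graph_1: "\<theta> (johnson_graph N 1) \<le> 1"
  by (rule clique_cover_number_johnson_graph_complete) (auto simp: nsets_def card_1_singleton_iff)

text \<open>Two distinct \<open>k\<close>-sets meet in fewer than \<open>k\<close> points, while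
  their union has at most \<open>k + 1\<close> points, so by inclusion-exclusion they meet in at
  least \<open>k - 1\<close>.\<close>

lemma clique_cover_number_johnson_graph_Suc_self: "\<theta> (johnson_graph (Suc k) k) \<le> 1"
proof (rule clique_cover_number_johnson_graph_complete)
  fix S T :: "nat set"
  assume "S \<in> nsets {1..Suc k} k" "T \<in> nsets {1..Suc k} k" "S \<noteq> T"
  then have S: "S \<subseteq> {1..Suc k}" "finite S" "card S = k"
    and T: "T \<subseteq> {1..Suc k}" "finite T" "card T = k" and "S \<noteq> T"
    by (auto simp: nsets_def)
  \<comment> \<open>Otherwise \<open>S \<subseteq> T\<close>, and equal cardinalities would force
    \<open>S = T\<close>.\<close>
  have "S \<inter> T \<noteq> S"
    using S T \<open>S \<noteq> T\<close> card_subset_eq[of T S] by auto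
  with S have "card (S \<inter> T) < k"
    using psubset_card_mono[of S "S \<inter> T"] by auto
  moreover have "card (S \<union> T) \<le> Suc k"
    using card_mono[of "{1..Suc k}" "S \<union> T"] S T by simp
  moreover have "card (S \<union> T) + card (S \<inter> T) = k + k"
    using card_Un_Int[of S T] S T by simp
  ultimately show "card (S \<inter> T) + 1 = k" by linarith
qed

theorem theorem3p2:
  fixes N k :: nat
  assumes "N \<ge> 2" and "0 < k" and "k < N"
  shows "\<theta> (johnson_graph N k) \<le> (N - 2) choose (k - 1)"
  using assms
proof (induction N arbitrary: k rule: nat_induct_at_least)
  case base
  then have "k = 1" by simp
  then show ?case using clique_cover_number_johnson_graph_1[of 2] by simp
next
  case (Suc N)
  \<comment> \<open>In the first two cases the binomial coefficient is 1. In the third, both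
    \<open>k - 1\<close> and \<open>k\<close> lie strictly between 0 and \<open>N\<close>, so the
    induction hypothesis applies to each.\<close>
  consider "k = 1" | "k = N" | "1 < k" "k < N" using Suc.prems by linarith
  then show ?case
  proof cases
    case 1
    then show ?thesis using clique_cover_number_johnson_graph_1[of "Suc N"] by simp
  next
    case 2
    then show ?thesis using clique_cover_number_johnson_graph_Suc_self[of N] by simp
  next
    case 3
    \<comment> \<open>Writing \<open>N = m + 2\<close> and \<open>k = j + 2\<close> removes the
      truncated subtractions; the target becomes \<open>Suc m choose Suc j\<close>, to which
      Pascal's rule applies.\<close>
    obtain m where m: "N = Suc (Suc m)" using Suc.hyps by (metis add_2_eq_Suc le_Suc_ex)
    obtain j where j: "k = Suc (Suc j)" using 3 by (metis One_nat_def less_iff_Suc_add plus_1_eq_Suc add_Suc)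
    have "\<theta> (johnson_graph (Suc N) k) \<le>
        \<theta> (johnson_graph N (Suc j)) + \<theta> (johnson_graph N k)"
      unfolding j by (rule clique_cover_number_johnson_graph_Suc_Suc)
    also have "\<dots> \<le> (m choose j) + (m choose Suc j)"
      using Suc.IH[of "Suc j"] Suc.IH[of k] 3 by (intro add_mono) (simp_all add: m j)
    also have "\<dots> = (Suc N - 2) choose (k - 1)" by (simp add: m j)
    finally show ?thesis .
  qed
qed

end
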